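(* Let $M$ be a connected, compact Riemannian manifold, let $N$ be a smooth manifold, and let $u:M\to N$ be a smooth map. If for some Morse function $f$ on $M$ one has $\mathrm{d}u(\nabla f)=0$ (identically on $M$), then $u$ is a constant map.
   Context: Manifolds are smooth and without boundary. A Morse function on $M$ is a smooth function $f:M\to\mathbb{R}$ all of whose critical points are non-degenerate (the Hessian of $f$ at each critical point is non-degenerate). The gradient $\nabla f$ is taken with respect to the Riemannian metric of $M$. *)

theory Defs
  imports "HOL-Analysis.Analysis"
begin

(* Model spaces of manifolds range over the sort {real_inner, heine_borel}: a normed space has the
   Heine-Borel property iff it is finite-dimensional.  Unlike euclidean_space, whose Basis is
   nonempty, this sort also admits a zero-dimensional space, so 0-dimensional manifolds are covered.
   All manifolds are modelled on one space and hence have constant dimension. *)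

section \<open>Smooth functions on open sets\<close>

(* Differentiability k times through directional derivatives; in finite dimension this is the usual
   notion of a C^k function on the open set S. *)
primrec Ck_on :: "nat \<Rightarrow> ('a::real_normed_vector \<Rightarrow> 'b::real_normed_vector) \<Rightarrow> 'a set \<Rightarrow> bool" where
  "Ck_on 0 f S \<longleftrightarrow> continuous_on S f"
| "Ck_on (Suc k) f S \<longleftrightarrow>
     (\<forall>x\<in>S. f differentiable (at x)) \<and> (\<forall>v. Ck_on k (\<lambda>x. frechet_derivative f (at x) v) S)"

definition smooth_on :: "('a::real_normed_vector \<Rightarrow> 'b::real_normed_vector) \<Rightarrow> 'a set \<Rightarrow> bool" where
  "smooth_on f S \<longleftrightarrow> (\<forall>k. Ck_on k f S)"


section \<open>Smooth manifolds and smooth maps\<close>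

datatype ('m, 'e) chart = Chart (domain: "'m set") (coord: "'m \<Rightarrow> 'e")

definition chart_image :: "('m, 'e) chart \<Rightarrow> 'e set" where
  "chart_image c = coord c ` domain c"

definition param :: "('m, 'e) chart \<Rightarrow> 'e \<Rightarrow> 'm" where
  "param c = inv_into (domain c) (coord c)"

definition chart_on :: "'m topology \<Rightarrow> ('m, 'e::{real_inner, heine_borel}) chart \<Rightarrow> bool" where
  "chart_on M c \<longleftrightarrow> openin M (domain c) \<and> open (chart_image c) \<and>
     homeomorphic_map (subtopology M (domain c)) (top_of_set (chart_image c)) (coord c)"

definition smooth_atlas :: "'m topology \<Rightarrow> ('m, 'e::{real_inner, heine_borel}) chart set \<Rightarrow> bool" where
  "smooth_atlas M A \<longleftrightarrow> (\<forall>c\<in>A. chart_on M c) \<and> (\<Union>c\<in>A. domain c) = topspace M \<and>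
     (\<forall>c\<in>A. \<forall>d\<in>A. smooth_on (coord d \<circ> param c) (coord c ` (domain c \<inter> domain d)))"

(* The smooth structure is the one determined by the atlas A, which need not be maximal. *)
definition smooth_manifold :: "'m topology \<Rightarrow> ('m, 'e::{real_inner, heine_borel}) chart set \<Rightarrow> bool" where
  "smooth_manifold M A \<longleftrightarrow> Hausdorff_space M \<and> second_countable M \<and> smooth_atlas M A"

definition smooth_map ::
  "'m topology \<Rightarrow> ('m, 'e::{real_inner, heine_borel}) chart set \<Rightarrow>
   'n topology \<Rightarrow> ('n, 'f::{real_inner, heine_borel}) chart set \<Rightarrow> ('m \<Rightarrow> 'n) \<Rightarrow> bool" where
  "smooth_map M A N B u \<longleftrightarrow> continuous_map M N u \<and>
     (\<forall>c\<in>A. \<forall>d\<in>B. smooth_on (coord d \<circ> u \<circ> param c) (coord c ` (domain c \<inter> u -` domain d)))"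

definition real_chart :: "(real, real) chart" where
  "real_chart = Chart UNIV id"


section \<open>Tangent vectors and differentials\<close>

definition charts_at :: "('m, 'e) chart set \<Rightarrow> 'm \<Rightarrow> ('m, 'e) chart set" where
  "charts_at A p = {c \<in> A. p \<in> domain c}"

(* A tangent vector at p assigns to each chart around p its coordinate vector, subject to the usual
   transformation law; it is 0 on the remaining charts so that equality of functions is equality of
   tangent vectors.  The vector space operations are pointwise. *)
definition tangent_space ::
  "('m, 'e::{real_inner, heine_borel}) chart set \<Rightarrow> 'm \<Rightarrow> (('m, 'e) chart \<Rightarrow> 'e) set" where
  "tangent_space A p = {v. (\<forall>c. c \<notin> charts_at A p \<longrightarrow> v c = 0) \<and>
     (\<forall>c\<in>charts_at A p. \<forall>d\<in>charts_at A p.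
        v d = frechet_derivative (coord d \<circ> param c) (at (coord c p)) (v c))}"

(* The tangent vector at p whose coordinate vector in the chart c is x. *)
definition tangent_vector ::
  "('m, 'e::{real_inner, heine_borel}) chart set \<Rightarrow> 'm \<Rightarrow> ('m, 'e) chart \<Rightarrow> 'e \<Rightarrow> ('m, 'e) chart \<Rightarrow> 'e" where
  "tangent_vector A p c x =
     (\<lambda>d. if d \<in> charts_at A p then frechet_derivative (coord d \<circ> param c) (at (coord c p)) x else 0)"

(* An arbitrary chart around p; what is defined from it below does not depend on the choice. *)
definition chart_at :: "('m, 'e) chart set \<Rightarrow> 'm \<Rightarrow> ('m, 'e) chart" where
  "chart_at A p = (SOME c. c \<in> charts_at A p)"

(* du_p : T_p M \<rightarrow> T_{u p} N *)
definition differential ::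
  "('m, 'e::{real_inner, heine_borel}) chart set \<Rightarrow> ('n, 'f::{real_inner, heine_borel}) chart set \<Rightarrow>
   ('m \<Rightarrow> 'n) \<Rightarrow> 'm \<Rightarrow> (('m, 'e) chart \<Rightarrow> 'e) \<Rightarrow> ('n, 'f) chart \<Rightarrow> 'f" where
  "differential A B u p v =
     (\<lambda>d. if d \<in> charts_at B (u p)
          then frechet_derivative (coord d \<circ> u \<circ> param (chart_at A p))
                 (at (coord (chart_at A p) p)) (v (chart_at A p))
          else 0)"

(* df_p as a linear form on T_p M, by the identification of T_{f p} R with R. *)
definition dform ::
  "('m, 'e::{real_inner, heine_borel}) chart set \<Rightarrow> ('m \<Rightarrow> real) \<Rightarrow> 'm \<Rightarrow> (('m, 'e) chart \<Rightarrow> 'e) \<Rightarrow> real" where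
  "dform A f p v = differential A {real_chart} f p v real_chart"


section \<open>Riemannian metrics, gradients and Morse functions\<close>

(* Smoothness of the metric means smoothness of its components g_ij in every chart. *)
definition riemannian_metric ::
  "'m topology \<Rightarrow> ('m, 'e::{real_inner, heine_borel}) chart set \<Rightarrow>
   ('m \<Rightarrow> (('m, 'e) chart \<Rightarrow> 'e) \<Rightarrow> (('m, 'e) chart \<Rightarrow> 'e) \<Rightarrow> real) \<Rightarrow> bool" where
  "riemannian_metric M A g \<longleftrightarrow>
     (\<forall>p\<in>topspace M.
        (\<forall>v\<in>tangent_space A p. \<forall>w\<in>tangent_space A p. g p v w = g p w v) \<and>
        (\<forall>v\<in>tangent_space A p. \<forall>w\<in>tangent_space A p. \<forall>z\<in>tangent_space A p. \<forall>a b.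
           g p (\<lambda>c. a *\<^sub>R v c + b *\<^sub>R w c) z = a * g p v z + b * g p w z) \<and>
        (\<forall>v\<in>tangent_space A p. v \<noteq> (\<lambda>c. 0) \<longrightarrow> g p v v > 0)) \<and>
     (\<forall>c\<in>A. \<forall>x y. smooth_on
        (\<lambda>z. g (param c z) (tangent_vector A (param c z) c x) (tangent_vector A (param c z) c y))
        (chart_image c))"

definition gradient ::
  "('m, 'e::{real_inner, heine_borel}) chart set \<Rightarrow>
   ('m \<Rightarrow> (('m, 'e) chart \<Rightarrow> 'e) \<Rightarrow> (('m, 'e) chart \<Rightarrow> 'e) \<Rightarrow> real) \<Rightarrow>
   ('m \<Rightarrow> real) \<Rightarrow> 'm \<Rightarrow> ('m, 'e) chart \<Rightarrow> 'e" where
  "gradient A g f p =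
     (THE v. v \<in> tangent_space A p \<and> (\<forall>w\<in>tangent_space A p. g p v w = dform A f p w))"

definition critical_point ::
  "('m, 'e::{real_inner, heine_borel}) chart set \<Rightarrow> ('m \<Rightarrow> real) \<Rightarrow> 'm \<Rightarrow> bool" where
  "critical_point A f p \<longleftrightarrow> (\<forall>v\<in>tangent_space A p. dform A f p v = 0)"

(* Second derivative of f in a chart; independent of the chart at critical points only. *)
definition hessian ::
  "('m, 'e::{real_inner, heine_borel}) chart set \<Rightarrow> ('m \<Rightarrow> real) \<Rightarrow> 'm \<Rightarrow>
   (('m, 'e) chart \<Rightarrow> 'e) \<Rightarrow> (('m, 'e) chart \<Rightarrow> 'e) \<Rightarrow> real" where
  "hessian A f p v w =
     (let c = chart_at A p in
        frechet_derivative (\<lambda>x. frechet_derivative (f \<circ> param c) (at x) (w c)) (at (coord c p)) (v c))"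

definition morse_function ::
  "'m topology \<Rightarrow> ('m, 'e::{real_inner, heine_borel}) chart set \<Rightarrow> ('m \<Rightarrow> real) \<Rightarrow> bool" where
  "morse_function M A f \<longleftrightarrow> smooth_map M A euclideanreal {real_chart} f \<and>
     (\<forall>p\<in>topspace M. critical_point A f p \<longrightarrow>
        (\<forall>v\<in>tangent_space A p. (\<forall>w\<in>tangent_space A p. hessian A f p v w = 0) \<longrightarrow> v = (\<lambda>c. 0)))"

end

theory Submission
  imports Defs
begin

text \<open>
  The map \<open>u\<close> takes only values that it already takes at critical points of \<open>f\<close>. Indeed, a fibre
  \<open>u\<^sup>-\<^sup>1(a)\<close> is compact, so \<open>f\<close> attains a minimum on it, at \<open>q\<close> say. If \<open>q\<close> were not critical, then the
  flow line of \<open>-\<nabla>f\<close> through \<open>q\<close> would stay in the fibre, because \<open>du(\<nabla>f) = 0\<close>, and \<open>f\<close> would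
  decrease along it. Critical points of a Morse function are isolated, hence finite in number on a
  compact manifold; so the image of \<open>u\<close> is finite, and since it is also a connected subset of
  a Hausdorff space, it is a point.

  That \<open>q\<close> is critical is shown here without integrating the gradient field
  (\<open>euclidean_fibre_minimum_critical\<close>). In charts, with \<open>h\<close> and \<open>\<phi>\<close> for \<open>u\<close> and \<open>f\<close> and \<open>x0\<close> for
  \<open>q\<close>, minimise the penalised function
  \<open>\<phi>(y) + k |h(y) - h(x0)|\<^sup>2 + |y - x0|\<^sup>2\<close> over a small ball. For large \<open>k\<close> the minimiser \<open>y\<close> is
  interior, and the derivative there in the direction \<open>X = \<nabla>\<phi>(y)\<close> vanishes. The penalty term does
  not contribute since \<open>dh(X) = 0\<close>, which leaves \<open>g(X, X) = d\<phi>(X) = -2 \<langle>y - x0, X\<rangle>\<close>. Since \<open>g\<close> is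
  uniformly positive definite near \<open>x0\<close>, this bounds \<open>|X|\<close> by a multiple of \<open>|y - x0|\<close>. Shrinking the
  ball yields points converging to \<open>x0\<close> along which the gradient of \<open>\<phi>\<close> tends to \<open>0\<close>.

  The model spaces come with an inner product and the Heine-Borel property but without a
  basis, so a finite orthonormal basis is constructed first. It serves to represent \<open>df\<close> by a gradient
  and to pass from the continuity of the components of the metric to its joint continuity.
\<close>

section \<open>Finite-dimensional inner product spaces\<close>

lemma compact_unit_sphere: "compact (sphere (0::'a::{real_normed_vector, heine_borel}) 1)"
proof -
  have "closed (sphere (0::'a) 1)"
    unfolding sphere_def by (intro closed_Collect_eq continuous_intros)
  then show ?thesis
    using bounded_subset[OF bounded_cball sphere_cball] compact_eq_bounded_closed by blast
qed

text \<open>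
  Two orthonormal vectors are at distance \<open>\<surd>2\<close>, so an infinite orthonormal set would be closed and
  bounded without having a limit point.
\<close>
lemma finite_orthonormal_set:
  fixes S :: "'a::{real_inner, heine_borel} set"
  assumes "pairwise orthogonal S" and "\<And>b. b \<in> S \<Longrightarrow> norm b = 1"
  shows "finite S"
proof (rule ccontr)
  assume "infinite S"
  have apart: "1 \<le> dist x y" if "x \<in> S" "y \<in> S" "x \<noteq> y" for x y
  proof -
    have "x \<bullet> y = 0"
      using that assms(1) by (auto simp: pairwise_def orthogonal_def)
    then have "(dist x y)\<^sup>2 = 2"
      using that assms(2) by (simp add: dist_norm power2_norm_eq_inner algebra_simps inner_commute norm_eq_1)
    then show ?thesis
      using power2_le_imp_le[of 1 "dist x y"] by simp
  qed
  have "closed S"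
    by (rule discrete_imp_closed[of 1]) (use apart in \<open>force simp: dist_commute\<close>)+
  moreover have "bounded S"
    using assms(2) by (metis bounded_iff order_refl)
  ultimately have "compact S"
    by (simp add: compact_eq_bounded_closed)
  then obtain x where x: "x \<in> S" "x islimpt S"
    using \<open>infinite S\<close> by (meson compact_eq_Bolzano_Weierstrass order_refl)
  then obtain y where y: "y \<in> S" "y \<noteq> x" "dist y x < 1"
    by (meson islimpt_approachable zero_less_one)
  with apart x show False by fastforce
qed

text \<open>
  A maximal orthonormal set is a basis: a nonzero residue of the expansion of \<open>x\<close> would be orthogonal
  to the set, and its normalisation could be added to it.
\<close>
lemma finite_orthonormal_basis:
  obtains B :: "'a::{real_inner, heine_borel} set"
  where "finite B" and "independent B" and "\<And>x. x = (\<Sum>b\<in>B. (x \<bullet> b) *\<^sub>R b)"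
proof -
  define \<O> where "\<O> = {S :: 'a set. pairwise orthogonal S \<and> (\<forall>b\<in>S. norm b = 1)}"
  have "\<Union>C \<in> \<O>" if "C \<in> chains \<O>" for C
  proof -
    have "orthogonal a b" if ab: "a \<in> X" "X \<in> C" "b \<in> Y" "Y \<in> C" "a \<noteq> b" for a b X Y
    proof -
      have "X \<subseteq> Y \<or> Y \<subseteq> X"
        using ab \<open>C \<in> chains \<O>\<close> by (meson chainsD)
      then obtain Z where "Z \<in> C" "a \<in> Z" "b \<in> Z"
        using ab by blast
      then show ?thesis
        using ab \<open>C \<in> chains \<O>\<close> by (auto simp: chains_def \<O>_def pairwise_def)
    qed
    then show ?thesis
      using \<open>C \<in> chains \<O>\<close> by (auto simp: chains_def \<O>_def pairwise_def)
  qed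
  then obtain B where B: "B \<in> \<O>" and max: "\<And>X. X \<in> \<O> \<Longrightarrow> B \<subseteq> X \<Longrightarrow> X = B"
    using Zorn_Lemma[of \<O>] by blast
  have pw: "pairwise orthogonal B" and unit: "\<And>b. b \<in> B \<Longrightarrow> norm b = 1"
    using B by (auto simp: \<O>_def)
  have fin: "finite B"
    by (rule finite_orthonormal_set[OF pw unit])
  have "independent B"
    by (rule pairwise_orthogonal_independent[OF pw]) (use unit in force)
  moreover have "x = (\<Sum>b\<in>B. (x \<bullet> b) *\<^sub>R b)" for x
  proof (rule ccontr)
    define r where "r = x - (\<Sum>b\<in>B. (x \<bullet> b) *\<^sub>R b)"
    assume "x \<noteq> (\<Sum>b\<in>B. (x \<bullet> b) *\<^sub>R b)"
    then have "r \<noteq> 0" by (simp add: r_def)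
    have r_orth: "r \<bullet> a = 0" if "a \<in> B" for a
    proof -
      have "(\<Sum>b\<in>B. (x \<bullet> b) * (b \<bullet> a)) = (\<Sum>b\<in>B. if b = a then x \<bullet> a else 0)"
        using that pw unit by (intro sum.cong) (auto simp: pairwise_def orthogonal_def norm_eq_1)
      then show ?thesis
        using that fin by (simp add: r_def inner_diff_left inner_sum_left)
    qed
    have "insert (sgn r) B \<in> \<O>"
      using B r_orth \<open>r \<noteq> 0\<close>
      by (auto simp: \<O>_def pairwise_insert orthogonal_def norm_sgn sgn_div_norm inner_commute)
    then have "sgn r \<in> B" using max by blast
    then have "r \<bullet> sgn r = 0" by (rule r_orth)
    then show False using \<open>r \<noteq> 0\<close> by (simp add: sgn_div_norm)
  qed
  ultimately show thesis using that fin by blast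
qed

lemma linear_basis_expansion:
  fixes l :: "'a::real_inner \<Rightarrow> real"
  assumes B: "\<And>x. x = (\<Sum>b\<in>B. (x \<bullet> b) *\<^sub>R b)" and l: "linear l"
  shows "l x = (\<Sum>b\<in>B. (x \<bullet> b) * l b)"
proof -
  have "l x = l (\<Sum>b\<in>B. (x \<bullet> b) *\<^sub>R b)"
    using B[of x] by simp
  also have "\<dots> = (\<Sum>b\<in>B. (x \<bullet> b) * l b)"
    by (simp add: linear_sum[OF l] linear_cmul[OF l])
  finally show ?thesis .
qed

lemma bilinear_basis_expansion:
  fixes G :: "'a::real_inner \<Rightarrow> 'a \<Rightarrow> real"
  assumes B: "\<And>x. x = (\<Sum>b\<in>B. (x \<bullet> b) *\<^sub>R b)" and "bilinear G"
  shows "G x y = (\<Sum>a\<in>B. \<Sum>b\<in>B. (x \<bullet> a) * (y \<bullet> b) * G a b)"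
proof -
  have l: "linear (\<lambda>x. G x y)" "linear (G x)" for x y
    using assms(2) by (auto simp: bilinear_def)
  have "G x y = (\<Sum>a\<in>B. (x \<bullet> a) * G a y)"
    by (rule linear_basis_expansion[OF B l(1)])
  also have "\<dots> = (\<Sum>a\<in>B. (x \<bullet> a) * (\<Sum>b\<in>B. (y \<bullet> b) * G a b))"
    by (intro sum.cong refl arg_cong2[where f = "(*)"] linear_basis_expansion[OF B l(2)])
  finally show ?thesis
    by (simp add: sum_distrib_left mult.assoc)
qed

text \<open>
  The linear map \<open>v \<mapsto> \<Sum>b. G(v, b) b\<close> has trivial kernel by positivity, hence is onto in finite
  dimension. This provides the gradient of a function.
\<close>
lemma riesz_representation_bilinear:
  fixes G :: "'a::{real_inner, heine_borel} \<Rightarrow> 'a \<Rightarrow> real"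
  assumes G: "bilinear G" and pos: "\<And>x. x \<noteq> 0 \<Longrightarrow> G x x > 0" and l: "linear l"
  obtains v where "\<And>w. G v w = l w"
proof -
  obtain B :: "'a set" where fin: "finite B" and ind: "independent B"
    and B: "\<And>x. x = (\<Sum>b\<in>B. (x \<bullet> b) *\<^sub>R b)"
    using finite_orthonormal_basis by blast
  have "(\<Sum>b\<in>B. (x \<bullet> b) *\<^sub>R b) \<in> span B" for x
    by (intro span_sum span_scale span_base)
  then have "span B = UNIV"
    using B by (metis UNIV_eq_I)
  then interpret fd: finite_dimensional_vector_space "(*\<^sub>R)" B
    by unfold_locales (use fin ind in \<open>auto simp: dependent_raw_def span_raw_def\<close>)
  have coeff0: "c b = 0" if "(\<Sum>b\<in>B. c b *\<^sub>R b) = 0" "b \<in> B" for c :: "'a \<Rightarrow> real" and b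
    using ind fin that independent_explicit_finite_subsets by blast
  define T where "T = (\<lambda>v. \<Sum>b\<in>B. G v b *\<^sub>R b)"
  have Gl: "linear (\<lambda>x. G x y)" "linear (G x)" for x y
    using G by (auto simp: bilinear_def)
  have "linear T"
    by (rule linearI)
       (simp_all add: T_def linear_add[OF Gl(1)] linear_cmul[OF Gl(1)] scaleR_add_left
          sum.distrib scaleR_sum_right)
  have "inj T"
  proof (rule linear_injective_0[OF \<open>linear T\<close>, THEN iffD2], intro allI impI)
    fix v assume "T v = 0"
    then have "G v b = 0" if "b \<in> B" for b
      using coeff0[of "G v" b] that by (simp add: T_def)
    then have "G v v = 0"
      using linear_basis_expansion[OF B Gl(2), of v v] by simp
    then show "v = 0" using pos[of v] by force
  qed
  have "surj T"
    using fd.linear_inj_imp_surj \<open>linear T\<close> \<open>inj T\<close>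
    by (simp add: linear_def)
  then obtain v where v: "T v = (\<Sum>b\<in>B. l b *\<^sub>R b)" by (metis surjD)
  have "(\<Sum>b\<in>B. (G v b - l b) *\<^sub>R b) = 0"
    using v by (simp add: T_def scaleR_diff_left sum_subtractf)
  then have eq: "G v b = l b" if "b \<in> B" for b
    using coeff0[of "\<lambda>b. G v b - l b" b] that by simp
  have "G v w = l w" for w
    using linear_basis_expansion[OF B Gl(2), of v w] linear_basis_expansion[OF B l, of w] eq by simp
  then show thesis using that by blast
qed

text \<open>
  The components of a metric are known to be continuous one at a time. Expanding
  in a finite basis makes the metric jointly continuous in the point and both vectors.
\<close>
lemma continuous_on_bilinear_family:
  fixes G :: "'c::topological_space \<Rightarrow> 'a::{real_inner, heine_borel} \<Rightarrow> 'a \<Rightarrow> real"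
  assumes bil: "\<And>z. z \<in> S \<Longrightarrow> bilinear (G z)" and cont: "\<And>a b. continuous_on S (\<lambda>z. G z a b)"
    and "continuous_on T \<zeta>" "\<And>t. t \<in> T \<Longrightarrow> \<zeta> t \<in> S" "continuous_on T \<xi>" "continuous_on T \<eta>"
  shows "continuous_on T (\<lambda>t. G (\<zeta> t) (\<xi> t) (\<eta> t))"
proof -
  obtain B :: "'a set" where B: "\<And>x. x = (\<Sum>b\<in>B. (x \<bullet> b) *\<^sub>R b)"
    using finite_orthonormal_basis by blast
  have "continuous_on T (\<lambda>t. G (\<zeta> t) a b)" for a b
    using continuous_on_compose2[OF cont assms(3)] assms(4) by blast
  then have "continuous_on T (\<lambda>t. \<Sum>a\<in>B. \<Sum>b\<in>B. (\<xi> t \<bullet> a) * (\<eta> t \<bullet> b) * G (\<zeta> t) a b)"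
    using assms(5,6) by (intro continuous_intros)
  then show ?thesis
    by (rule continuous_on_eq) (rule bilinear_basis_expansion[OF B bil[OF assms(4)], symmetric])
qed

text \<open>
  By compactness \<open>G(z, x, x)\<close> attains its minimum over \<open>z \<in> K\<close> and unit vectors \<open>x\<close>, and homogeneity
  extends the bound to all vectors.
\<close>
lemma uniformly_positive_definite:
  fixes G :: "'c::metric_space \<Rightarrow> 'a::{real_inner, heine_borel} \<Rightarrow> 'a \<Rightarrow> real"
  assumes "compact K" and bil: "\<And>z. z \<in> K \<Longrightarrow> bilinear (G z)"
    and cont: "\<And>a b. continuous_on K (\<lambda>z. G z a b)"
    and pos: "\<And>z x. z \<in> K \<Longrightarrow> x \<noteq> 0 \<Longrightarrow> G z x x > 0"
  obtains c where "c > 0" and "\<And>z x. z \<in> K \<Longrightarrow> G z x x \<ge> c * (norm x)\<^sup>2"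
proof -
  let ?T = "K \<times> sphere (0::'a) 1"
  have "compact ?T"
    by (intro compact_Times assms(1) compact_unit_sphere)
  have "continuous_on ?T (\<lambda>t. G (fst t) (snd t) (snd t))"
    by (rule continuous_on_bilinear_family[OF bil cont]) (auto intro!: continuous_intros)
  \<comment> \<open>There are no pairs to minimise over if \<open>K\<close> is empty or the space is zero-dimensional.\<close>
  then obtain c where c: "c > 0" "\<And>z x. z \<in> K \<Longrightarrow> norm x = 1 \<Longrightarrow> G z x x \<ge> c"
  proof (cases "?T = {}")
    case True
    then have "\<not> (z \<in> K \<and> norm x = 1)" for z and x :: 'a
      by auto
    then show ?thesis using that[of 1] by auto
  next
    case False
    then obtain t where t: "t \<in> ?T" "\<And>s. s \<in> ?T \<Longrightarrow> G (fst t) (snd t) (snd t) \<le> G (fst s) (snd s) (snd s)"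
      using continuous_attains_inf[OF \<open>compact ?T\<close> False \<open>continuous_on ?T _\<close>] by blast
    show ?thesis
    proof (rule that)
      have "snd t \<noteq> 0" using t(1) by auto
      then show "G (fst t) (snd t) (snd t) > 0" using pos t(1) by auto
      show "G z x x \<ge> G (fst t) (snd t) (snd t)" if "z \<in> K" "norm x = 1" for z x
        using t(2)[of "(z, x)"] that by auto
    qed
  qed
  show thesis
  proof (rule that[OF c(1)])
    fix z x assume z: "z \<in> K"
    have l: "linear (\<lambda>x. G z x y)" "linear (G z x)" for x y
      using bil[OF z] by (auto simp: bilinear_def)
    show "G z x x \<ge> c * (norm x)\<^sup>2"
    proof (cases "x = 0")
      case True
      then show ?thesis using linear_0[OF l(2)] by simp
    next
      case False
      have "c \<le> G z (sgn x) (sgn x)"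
        using c(2)[OF z] False by (simp add: norm_sgn)
      also have "\<dots> = G z x x / (norm x)\<^sup>2"
        by (simp add: sgn_div_norm linear_cmul[OF l(1)] linear_cmul[OF l(2)] power2_eq_square divide_inverse)
      finally show ?thesis using False by (simp add: field_simps)
    qed
  qed
qed
section \<open>Constrained minima by a penalty method\<close>

text \<open>
  Here \<open>x0\<close> minimises \<open>\<phi>\<close> on the level set of \<open>h\<close> through it. The penalised function takes the value
  \<open>\<phi>(x0)\<close> at \<open>x0\<close>, which bounds the penalty of its minimisers and forces every limit point of them, as
  \<open>k \<rightarrow> \<infinity>\<close>, onto the level set. On the level set \<open>\<phi> \<ge> \<phi>(x0)\<close>, so the term \<open>|y - x0|\<^sup>2\<close> leaves \<open>x0\<close> as the
  only possible limit, and for large \<open>k\<close> the minimiser lies in the open ball.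
\<close>
lemma penalised_minimum_near:
  fixes h :: "'a::{real_inner, heine_borel} \<Rightarrow> 'b::real_inner" and \<phi> :: "'a \<Rightarrow> real"
  assumes "r > 0" and ch: "continuous_on (cball x0 r) h" and c\<phi>: "continuous_on (cball x0 r) \<phi>"
    and min: "\<And>y. y \<in> cball x0 r \<Longrightarrow> h y = h x0 \<Longrightarrow> \<phi> x0 \<le> \<phi> y"
  obtains y k where "y \<in> ball x0 r" and
    "\<And>z. z \<in> cball x0 r \<Longrightarrow>
       \<phi> y + k * (norm (h y - h x0))\<^sup>2 + (norm (y - x0))\<^sup>2
       \<le> \<phi> z + k * (norm (h z - h x0))\<^sup>2 + (norm (z - x0))\<^sup>2"
proof -
  define F where "F n z = \<phi> z + real n * (norm (h z - h x0))\<^sup>2 + (norm (z - x0))\<^sup>2" for n z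
  have K: "compact (cball x0 r)" "cball x0 r \<noteq> {}"
    using \<open>r > 0\<close> by (auto simp: compact_eq_bounded_closed)
  have "continuous_on (cball x0 r) (F n)" for n
    unfolding F_def by (intro continuous_intros ch c\<phi>)
  then have "\<exists>y\<in>cball x0 r. \<forall>z\<in>cball x0 r. F n y \<le> F n z" for n
    using continuous_attains_inf[OF K] by blast
  then obtain y where y: "\<And>n. y n \<in> cball x0 r" and ymin: "\<And>n z. z \<in> cball x0 r \<Longrightarrow> F n (y n) \<le> F n z"
    by metis
  obtain m where m: "\<And>z. z \<in> cball x0 r \<Longrightarrow> m \<le> \<phi> z"
    using continuous_attains_inf[OF K c\<phi>] by blast
  \<comment> \<open>The comparison with the value at \<open>x0\<close> controls the minimisers.\<close>
  have F0: "F n (y n) \<le> \<phi> x0" for n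
    using ymin[of x0 n] \<open>r > 0\<close> by (simp add: F_def)
  obtain s a where a: "a \<in> cball x0 r" "strict_mono (s :: nat \<Rightarrow> nat)" and lim: "(y \<circ> s) \<longlonglongrightarrow> a"
    using K(1) y unfolding compact_def by metis
  have lim_comp: "(\<lambda>n. q (y (s n))) \<longlonglongrightarrow> q a" if "continuous_on (cball x0 r) q" for q :: "'a \<Rightarrow> real"
    using continuous_on_tendsto_compose[OF that lim[unfolded o_def] a(1)] y by simp
  have "(\<lambda>n. (norm (h (y (s n)) - h x0))\<^sup>2) \<longlonglongrightarrow> (norm (h a - h x0))\<^sup>2"
    by (rule lim_comp) (intro continuous_intros ch)
  moreover have "(\<lambda>n. (norm (h (y (s n)) - h x0))\<^sup>2) \<longlonglongrightarrow> 0"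
  proof (rule tendsto_sandwich[OF _ _ tendsto_const])
    have "(norm (h (y (s n)) - h x0))\<^sup>2 \<le> (\<phi> x0 - m) / real (s n)" if "n > 0" for n
    proof -
      have "s n > 0" using that a(2) seq_suble[of s n] by simp
      moreover have "real (s n) * (norm (h (y (s n)) - h x0))\<^sup>2 \<le> \<phi> x0 - m"
        using F0[of "s n"] m[OF y[of "s n"]] zero_le_power2[of "norm (y (s n) - x0)"] unfolding F_def
        by linarith
      ultimately show ?thesis by (simp add: field_simps)
    qed
    then show "\<forall>\<^sub>F n in sequentially. (norm (h (y (s n)) - h x0))\<^sup>2 \<le> (\<phi> x0 - m) / real (s n)"
      by (auto intro: eventually_sequentiallyI[of 1])
    show "(\<lambda>n. (\<phi> x0 - m) / real (s n)) \<longlonglongrightarrow> 0"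
      by (rule real_tendsto_divide_at_top[OF tendsto_const])
        (rule filterlim_compose[OF filterlim_real_sequentially filterlim_subseq[OF a(2)]])
  qed auto
  ultimately have "(norm (h a - h x0))\<^sup>2 = 0"
    using LIMSEQ_unique by blast
  then have "\<phi> x0 \<le> \<phi> a" using min a(1) by simp
  moreover have "\<phi> a + (norm (a - x0))\<^sup>2 \<le> \<phi> x0"
  proof (rule LIMSEQ_le_const2)
    show "(\<lambda>n. \<phi> (y (s n)) + (norm (y (s n) - x0))\<^sup>2) \<longlonglongrightarrow> \<phi> a + (norm (a - x0))\<^sup>2"
      by (rule lim_comp) (intro continuous_intros c\<phi>)
    have "0 \<le> real (s n) * (norm (h (y (s n)) - h x0))\<^sup>2" for n by simp
    then have "\<phi> (y (s n)) + (norm (y (s n) - x0))\<^sup>2 \<le> \<phi> x0" for n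
      using F0[of "s n"] unfolding F_def by (smt (verit))
    then show "\<exists>N. \<forall>n\<ge>N. \<phi> (y (s n)) + (norm (y (s n) - x0))\<^sup>2 \<le> \<phi> x0" by blast
  qed
  ultimately have "(norm (a - x0))\<^sup>2 \<le> 0" by linarith
  then have "a = x0" by simp
  then have "\<forall>\<^sub>F n in sequentially. dist (y (s n)) x0 < r"
    using lim \<open>r > 0\<close> by (auto simp: tendsto_iff o_def)
  then obtain n where "dist (y (s n)) x0 < r"
    using eventually_happens by force
  then show thesis
    using that[of "y (s n)" "real (s n)"] ymin[of _ "s n"] by (simp add: F_def dist_commute)
qed

text \<open>
  The first-order condition at an interior minimum of the penalised function, in the direction \<open>X y\<close>.
  The penalty term drops out because \<open>X y\<close> lies in the kernel of the derivative of \<open>h\<close>; this replaces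
  moving along the integral curves of \<open>X\<close>.
\<close>
lemma constrained_minimum_nearby_derivative:
  fixes h :: "'a::{real_inner, heine_borel} \<Rightarrow> 'b::real_inner" and \<phi> :: "'a \<Rightarrow> real"
  assumes "r > 0"
    and dh: "\<And>y. y \<in> cball x0 r \<Longrightarrow> (h has_derivative h' y) (at y)"
    and d\<phi>: "\<And>y. y \<in> cball x0 r \<Longrightarrow> (\<phi> has_derivative \<phi>' y) (at y)"
    and min: "\<And>y. y \<in> cball x0 r \<Longrightarrow> h y = h x0 \<Longrightarrow> \<phi> x0 \<le> \<phi> y"
    and ker: "\<And>y. y \<in> cball x0 r \<Longrightarrow> h' y (X y) = 0"
  obtains y where "y \<in> ball x0 r" and "\<phi>' y (X y) = - 2 * ((y - x0) \<bullet> X y)"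
proof -
  have "continuous_on (cball x0 r) h" "continuous_on (cball x0 r) \<phi>"
    using dh d\<phi> by (meson continuous_at_imp_continuous_on has_derivative_continuous)+
  then obtain y k where y: "y \<in> ball x0 r" and ymin: 
    "\<And>z. z \<in> cball x0 r \<Longrightarrow>
       \<phi> y + k * (norm (h y - h x0))\<^sup>2 + (norm (y - x0))\<^sup>2
       \<le> \<phi> z + k * (norm (h z - h x0))\<^sup>2 + (norm (z - x0))\<^sup>2"
    using penalised_minimum_near[where h = h and \<phi> = \<phi>, OF \<open>r > 0\<close>] min by metis
  let ?F = "\<lambda>z. \<phi> z + k * ((h z - h x0) \<bullet> (h z - h x0)) + (z - x0) \<bullet> (z - x0)"
  let ?F' = "\<lambda>v. \<phi>' y v + k * (2 * ((h y - h x0) \<bullet> h' y v)) + 2 * ((y - x0) \<bullet> v)"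
  have yc: "y \<in> cball x0 r" using y by auto
  have "(?F has_derivative ?F') (at y)"
    by (rule derivative_eq_intros dh[OF yc] d\<phi>[OF yc] refl)+ (auto simp: inner_commute)
  then have "?F' = (\<lambda>v. 0)"
    by (rule differential_zero_maxmin[OF y open_ball])
       (use ymin in \<open>auto simp: power2_norm_eq_inner\<close>)
  then have "?F' (X y) = 0" by metis
  then show thesis
    using that y ker[OF yc] by simp
qed

text \<open>
  The local form of the statement that a minimum of \<open>\<phi>\<close> on a fibre of \<open>h\<close> is critical when \<open>h\<close> is
  infinitesimally constant along the gradient \<open>X\<close> of \<open>\<phi>\<close> for the metric \<open>G\<close>. On balls shrinking to
  \<open>x0\<close> the preceding lemma yields points \<open>y\<close> with \<open>c |X y|\<^sup>2 \<le> G(X y, X y) \<le> 2 |y - x0| |X y|\<close>, so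
  \<open>X y \<rightarrow> 0\<close> and therefore \<open>\<phi>'(y) = G(X y, \<cdot>) \<rightarrow> 0\<close>.
\<close>
lemma euclidean_fibre_minimum_critical:
  fixes h :: "'a::{real_inner, heine_borel} \<Rightarrow> 'b::real_inner" and \<phi> :: "'a \<Rightarrow> real"
  assumes "R > 0"
    and dh: "\<And>y. y \<in> cball x0 R \<Longrightarrow> (h has_derivative h' y) (at y)"
    and d\<phi>: "\<And>y. y \<in> cball x0 R \<Longrightarrow> (\<phi> has_derivative \<phi>' y) (at y)"
    and cont: "\<And>w. continuous_on (cball x0 R) (\<lambda>y. \<phi>' y w)"
    and bil: "\<And>y. y \<in> cball x0 R \<Longrightarrow> bilinear (G y)"
    and Gcont: "\<And>a b. continuous_on (cball x0 R) (\<lambda>y. G y a b)"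
    and pos: "\<And>y x. y \<in> cball x0 R \<Longrightarrow> x \<noteq> 0 \<Longrightarrow> G y x x > 0"
    and grad: "\<And>y w. y \<in> cball x0 R \<Longrightarrow> G y (X y) w = \<phi>' y w"
    and ker: "\<And>y. y \<in> cball x0 R \<Longrightarrow> h' y (X y) = 0"
    and min: "\<And>y. y \<in> cball x0 R \<Longrightarrow> h y = h x0 \<Longrightarrow> \<phi> x0 \<le> \<phi> y"
  shows "\<phi>' x0 w = 0"
proof -
  let ?K = "cball x0 R"
  have x0: "x0 \<in> ?K" using \<open>R > 0\<close> by simp
  have "compact ?K" by (simp add: compact_eq_bounded_closed)
  then obtain c where c: "c > 0" "\<And>y x. y \<in> ?K \<Longrightarrow> c * (norm x)\<^sup>2 \<le> G y x x"
    using uniformly_positive_definite[of ?K G] bil Gcont pos by metis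
  have near: "\<exists>y. y \<in> ball x0 r \<and> \<phi>' y (X y) = - 2 * ((y - x0) \<bullet> X y)" if r: "r > 0" "r \<le> R" for r
  proof -
    have sub: "cball x0 r \<subseteq> ?K" using r by auto
    obtain y where "y \<in> ball x0 r" "\<phi>' y (X y) = - 2 * ((y - x0) \<bullet> X y)"
      by (rule constrained_minimum_nearby_derivative[of r x0 h h' \<phi> \<phi>' X])
         (use r(1) sub dh d\<phi> min ker in auto)
    then show ?thesis by blast
  qed
  have "\<exists>y. y \<in> ball x0 (R * inverse (real (Suc n))) \<and> \<phi>' y (X y) = - 2 * ((y - x0) \<bullet> X y)" for n
  proof -
    have "0 < R * inverse (real (Suc n))" "R * inverse (real (Suc n)) \<le> R"
      using \<open>R > 0\<close> by (simp_all add: field_simps)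
    then show ?thesis by (rule near)
  qed
  then obtain y where y: "\<And>n. dist x0 (y n) < R * inverse (real (Suc n))"
    and y_eq: "\<And>n. \<phi>' (y n) (X (y n)) = - 2 * ((y n - x0) \<bullet> X (y n))"
    unfolding mem_ball by metis
  have yK: "y n \<in> ?K" for n
  proof -
    have "R * inverse (real (Suc n)) \<le> R" using \<open>R > 0\<close> by (simp add: field_simps)
    then show ?thesis using y[of n] by simp
  qed
  have "norm (dist (y n) x0) \<le> R * inverse (real (Suc n))" for n
    using y[of n] by (simp add: dist_commute)
  moreover have "(\<lambda>n. R * inverse (real (Suc n))) \<longlonglongrightarrow> 0"
    using tendsto_mult[OF tendsto_const LIMSEQ_inverse_real_of_nat, of R] by simp
  ultimately have dist_lim: "(\<lambda>n. dist (y n) x0) \<longlonglongrightarrow> 0"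
    by (rule Lim_null_comparison[OF always_eventually[OF allI]])
  then have y_lim: "y \<longlonglongrightarrow> x0" by (rule tendsto_dist_iff[THEN iffD2])
  have "norm (X (y n)) \<le> 2 / c * dist (y n) x0" for n
  proof (cases "X (y n) = 0")
    case False
    have "c * (norm (X (y n)))\<^sup>2 \<le> - 2 * ((y n - x0) \<bullet> X (y n))"
      using c(2)[OF yK] grad[OF yK] y_eq by metis
    also have "\<dots> \<le> 2 * (dist (y n) x0 * norm (X (y n)))"
      using abs_le_D2[OF Cauchy_Schwarz_ineq2[of "y n - x0" "X (y n)"]] by (simp only: dist_norm)
    finally have "norm (X (y n)) * (c * norm (X (y n))) \<le> norm (X (y n)) * (2 * dist (y n) x0)"
      by (simp only: power2_eq_square mult_ac)
    then have "c * norm (X (y n)) \<le> 2 * dist (y n) x0"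
      by (rule mult_left_le_imp_le) (use False in simp)
    then show ?thesis using c(1) by (simp add: pos_le_divide_eq mult.commute)
  qed (use c(1) in simp)
  moreover have "(\<lambda>n. 2 / c * dist (y n) x0) \<longlonglongrightarrow> 0"
    using tendsto_mult[OF tendsto_const dist_lim, of "2 / c"] by simp
  ultimately have "(\<lambda>n. X (y n)) \<longlonglongrightarrow> 0"
    by (rule Lim_null_comparison[OF always_eventually[OF allI]])
  with y_lim have pair_lim: "(\<lambda>n. (y n, X (y n))) \<longlonglongrightarrow> (x0, 0)"
    by (rule tendsto_Pair)
  have "continuous_on (?K \<times> UNIV) (\<lambda>t. G (fst t) (snd t) w)"
    by (rule continuous_on_bilinear_family[OF bil Gcont]) (auto intro!: continuous_intros)
  from continuous_on_tendsto_compose[OF this pair_lim]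
  have "(\<lambda>n. G (y n) (X (y n)) w) \<longlonglongrightarrow> G x0 0 w"
    using x0 yK by simp
  then have "(\<lambda>n. \<phi>' (y n) w) \<longlonglongrightarrow> 0"
    using grad[OF yK] bilinear_lzero[OF bil[OF x0]] by simp
  moreover have "(\<lambda>n. \<phi>' (y n) w) \<longlonglongrightarrow> \<phi>' x0 w"
    using continuous_on_tendsto_compose[OF cont y_lim x0] yK by simp
  ultimately show ?thesis using LIMSEQ_unique by blast
qed

section \<open>Smooth functions and charts\<close>

lemma smooth_on_differentiable: "smooth_on f S \<Longrightarrow> x \<in> S \<Longrightarrow> f differentiable (at x)"
  unfolding smooth_on_def by (metis Ck_on.simps(2))

lemma smooth_on_has_derivative:
  "smooth_on f S \<Longrightarrow> x \<in> S \<Longrightarrow> (f has_derivative frechet_derivative f (at x)) (at x)"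
  using smooth_on_differentiable frechet_derivative_works by blast

lemma smooth_on_derivative: "smooth_on f S \<Longrightarrow> smooth_on (\<lambda>x. frechet_derivative f (at x) v) S"
  unfolding smooth_on_def by (metis Ck_on.simps(2))

lemma smooth_on_continuous: "smooth_on f S \<Longrightarrow> continuous_on S f"
  unfolding smooth_on_def by (metis Ck_on.simps(1))

lemma smooth_on_subset: 
  assumes "smooth_on f S" "T \<subseteq> S" shows "smooth_on f T"
proof -
  have "Ck_on k f S \<Longrightarrow> Ck_on k f T" for k and f :: "'a \<Rightarrow> 'b"
    by (induction k arbitrary: f) (use \<open>T \<subseteq> S\<close> in \<open>auto intro: continuous_on_subset\<close>)
  then show ?thesis using assms(1) by (simp add: smooth_on_def)
qed

lemma charts_atI: "c \<in> A \<Longrightarrow> p \<in> domain c \<Longrightarrow> c \<in> charts_at A p"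
  by (simp add: charts_at_def)

lemma charts_atD: "c \<in> charts_at A p \<Longrightarrow> c \<in> A" "c \<in> charts_at A p \<Longrightarrow> p \<in> domain c"
  by (simp_all add: charts_at_def)

lemma chart_on_domain: "chart_on M c \<Longrightarrow> domain c \<subseteq> topspace M"
  unfolding chart_on_def using openin_subset by blast

lemma chart_on_inj:
  assumes "chart_on M c" shows "inj_on (coord c) (domain c)"
  using assms homeomorphic_imp_injective_map chart_on_domain[OF assms]
  by (fastforce simp: chart_on_def Int_absorb1)

lemma param_coord: "chart_on M c \<Longrightarrow> p \<in> domain c \<Longrightarrow> param c (coord c p) = p"
  unfolding param_def using chart_on_inj by (metis inv_into_f_f)

lemma coord_param: "z \<in> chart_image c \<Longrightarrow> coord c (param c z) = z"
  unfolding param_def chart_image_def by (rule f_inv_into_f)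

lemma param_in_domain: "z \<in> chart_image c \<Longrightarrow> param c z \<in> domain c"
  unfolding param_def chart_image_def by (rule inv_into_into)

lemma param_image_subset:
  "chart_on M c \<Longrightarrow> z \<in> coord c ` (domain c \<inter> U) \<Longrightarrow> param c z \<in> domain c \<inter> U"
  using param_coord by fastforce

lemma open_coord_image:
  assumes "chart_on M c" "openin M U"
  shows "open (coord c ` (domain c \<inter> U))"
proof -
  have "openin (subtopology M (domain c)) (domain c \<inter> U)"
    using assms(2) by (auto simp: openin_subtopology)
  then have "openin (top_of_set (chart_image c)) (coord c ` (domain c \<inter> U))"
    using assms(1) homeomorphic_imp_open_map unfolding chart_on_def open_map_def by blast
  then show ?thesis
    using assms(1) openin_open_trans unfolding chart_on_def by blast
qed

lemma openin_coord_preimage: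
  assumes "chart_on M c" "open V"
  shows "openin M {x \<in> domain c. coord c x \<in> V}"
proof -
  have "continuous_map (subtopology M (domain c)) euclidean (coord c)"
    using assms(1) homeomorphic_imp_continuous_map continuous_map_into_fulltopology
    unfolding chart_on_def by blast
  then have "openin (subtopology M (domain c)) {x \<in> topspace (subtopology M (domain c)). coord c x \<in> V}"
    using assms(2) by (intro openin_continuous_map_preimage) auto
  then have "openin M {x \<in> topspace (subtopology M (domain c)). coord c x \<in> V}"
    using assms(1) openin_trans_full unfolding chart_on_def by blast
  then show ?thesis
    using chart_on_domain[OF assms(1)] by (simp add: Int_absorb1)
qed

lemma smooth_atlas_chart: "smooth_atlas M A \<Longrightarrow> c \<in> A \<Longrightarrow> chart_on M c"
  by (simp add: smooth_atlas_def)

lemma chart_at_in: 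
  assumes "smooth_atlas M A" "p \<in> topspace M" shows "chart_at A p \<in> charts_at A p"
proof -
  have "\<exists>c. c \<in> charts_at A p"
    using assms by (auto simp: smooth_atlas_def charts_at_def)
  then show ?thesis unfolding chart_at_def by (rule someI_ex)
qed

text \<open>
  The chain rule for \<open>\<phi> \<circ> param c = (\<phi> \<circ> param d) \<circ> (coord d \<circ> param c)\<close>, an identity that holds
  only on the overlap of the two charts. It makes differentials, which are defined through
  an arbitrarily selected chart, computable in any chart.
\<close>
lemma has_derivative_chart_change:
  fixes A :: "('m, 'e::{real_inner, heine_borel}) chart set"
    and \<phi> :: "'m \<Rightarrow> 'b::real_normed_vector"
  assumes A: "smooth_atlas M A" and c: "c \<in> charts_at A p" and d: "d \<in> charts_at A p"
    and diff: "(\<phi> \<circ> param d) differentiable (at (coord d p))"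
  shows "((\<phi> \<circ> param c) has_derivative
      (\<lambda>x. frechet_derivative (\<phi> \<circ> param d) (at (coord d p))
             (frechet_derivative (coord d \<circ> param c) (at (coord c p)) x))) (at (coord c p))"
proof -
  note cd = charts_atD[OF c] charts_atD[OF d]
  have ch: "chart_on M c" "chart_on M d"
    using A cd by (auto simp: smooth_atlas_chart)
  let ?S = "coord c ` (domain c \<inter> domain d)"
  have "openin M (domain d)" using ch(2) by (simp add: chart_on_def)
  then have "open ?S" by (rule open_coord_image[OF ch(1)])
  have p: "coord c p \<in> ?S" using cd by auto
  have "smooth_on (coord d \<circ> param c) ?S"
    using A cd by (simp add: smooth_atlas_def)
  then have "(coord d \<circ> param c has_derivative frechet_derivative (coord d \<circ> param c) (at (coord c p)))
      (at (coord c p))"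
    using p by (rule smooth_on_has_derivative)
  moreover have "(\<phi> \<circ> param d has_derivative frechet_derivative (\<phi> \<circ> param d) (at (coord d p)))
      (at ((coord d \<circ> param c) (coord c p)))"
    using diff param_coord[OF ch(1) cd(2)] by (simp add: frechet_derivative_works)
  ultimately have "((\<phi> \<circ> param d) \<circ> (coord d \<circ> param c) has_derivative
      frechet_derivative (\<phi> \<circ> param d) (at (coord d p)) \<circ>
      frechet_derivative (coord d \<circ> param c) (at (coord c p))) (at (coord c p))"
    by (rule diff_chain_at)
  then have "(\<phi> \<circ> param c has_derivative
      frechet_derivative (\<phi> \<circ> param d) (at (coord d p)) \<circ>
      frechet_derivative (coord d \<circ> param c) (at (coord c p))) (at (coord c p))"
  proof (rule has_derivative_transform_within_open[OF _ \<open>open ?S\<close> p])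
    fix z assume "z \<in> ?S"
    then show "((\<phi> \<circ> param d) \<circ> (coord d \<circ> param c)) z = (\<phi> \<circ> param c) z"
      using param_image_subset[OF ch(1)] param_coord[OF ch(2)] by (metis IntD2 comp_apply)
  qed
  then show ?thesis by (simp add: o_def)
qed

lemma has_derivative_chart_transition:
  fixes A :: "('m, 'e::{real_inner, heine_borel}) chart set"
  assumes A: "smooth_atlas M A" and c: "c \<in> charts_at A p" and d: "d \<in> charts_at A p"
  shows "((coord d \<circ> param c) has_derivative frechet_derivative (coord d \<circ> param c) (at (coord c p)))
    (at (coord c p))"
proof (rule smooth_on_has_derivative)
  show "smooth_on (coord d \<circ> param c) (coord c ` (domain c \<inter> domain d))"
    using A charts_atD[OF c] charts_atD[OF d] by (simp add: smooth_atlas_def)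
qed (use charts_atD[OF c] charts_atD[OF d] in auto)

text \<open>
  This is what makes \<open>tangent_vector A p c x\<close> satisfy the transformation law of tangent vectors.
\<close>
lemma chart_transition_cocycle:
  assumes A: "smooth_atlas M A" and "c \<in> charts_at A p" "d \<in> charts_at A p" "e \<in> charts_at A p"
  shows "frechet_derivative (coord e \<circ> param c) (at (coord c p)) x =
    frechet_derivative (coord e \<circ> param d) (at (coord d p))
      (frechet_derivative (coord d \<circ> param c) (at (coord c p)) x)"
proof -
  have "(coord e \<circ> param d) differentiable (at (coord d p))"
    using has_derivative_chart_transition[OF A assms(3,4)] by (auto simp: differentiable_def)
  from frechet_derivative_at[OF has_derivative_chart_change[OF A assms(2,3) this]]
  show ?thesis by metis
qed

lemma chart_transition_self:
  assumes A: "smooth_atlas M A" and c: "c \<in> charts_at A p"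
  shows "frechet_derivative (coord c \<circ> param c) (at (coord c p)) x = x"
proof -
  have ch: "chart_on M c" using A charts_atD[OF c] by (simp add: smooth_atlas_chart)
  have "((\<lambda>z. z) has_derivative (\<lambda>x. x)) (at (coord c p))" by (rule has_derivative_ident)
  moreover have "open (chart_image c)" "coord c p \<in> chart_image c"
    using ch charts_atD[OF c] by (auto simp: chart_on_def chart_image_def)
  ultimately have "(coord c \<circ> param c has_derivative (\<lambda>x. x)) (at (coord c p))"
    by (rule has_derivative_transform_within_open) (simp add: coord_param)
  from frechet_derivative_at[OF this] show ?thesis by metis
qed

lemma tangent_space_transition:
  assumes "v \<in> tangent_space A p" and "c \<in> charts_at A p" and "d \<in> charts_at A p"
  shows "frechet_derivative (coord d \<circ> param c) (at (coord c p)) (v c) = v d"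
  by (rule assms(1)[unfolded tangent_space_def, THEN CollectD, THEN conjunct2, rule_format,
        symmetric, OF assms(2,3)])

lemma tangent_vector_in_tangent_space:
  assumes "smooth_atlas M A" and "c \<in> charts_at A p"
  shows "tangent_vector A p c x \<in> tangent_space A p"
  unfolding tangent_space_def tangent_vector_def
  by (simp add: chart_transition_cocycle[OF assms, symmetric])

lemma tangent_vector_apply:
  assumes "smooth_atlas M A" and "c \<in> charts_at A p"
  shows "tangent_vector A p c x c = x"
  using chart_transition_self[OF assms] assms(2) by (simp add: tangent_vector_def)

text \<open>
  Together with \<open>tangent_vector_apply\<close> this identifies the tangent space at \<open>p\<close> with the model space,
  so that forms on the tangent space become forms on the model space.
\<close>
lemma tangent_vector_coordinate:
  assumes "c \<in> charts_at A p" and "v \<in> tangent_space A p"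
  shows "tangent_vector A p c (v c) = v"
proof
  fix d
  show "tangent_vector A p c (v c) d = v d"
  proof (cases "d \<in> charts_at A p")
    case True
    then show ?thesis
      using tangent_space_transition[OF assms(2,1)] by (simp add: tangent_vector_def)
  next
    case False
    then have "v d = 0" using assms(2) unfolding tangent_space_def by blast
    then show ?thesis using False by (simp add: tangent_vector_def)
  qed
qed

lemma tangent_vector_linear:
  assumes A: "smooth_atlas M A" and "c \<in> charts_at A p"
  shows "tangent_vector A p c (a *\<^sub>R x + b *\<^sub>R y) =
    (\<lambda>d. a *\<^sub>R tangent_vector A p c x d + b *\<^sub>R tangent_vector A p c y d)"
proof
  fix d
  show "tangent_vector A p c (a *\<^sub>R x + b *\<^sub>R y) d =
    a *\<^sub>R tangent_vector A p c x d + b *\<^sub>R tangent_vector A p c y d"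
  proof (cases "d \<in> charts_at A p")
    case True
    then have "linear (frechet_derivative (coord d \<circ> param c) (at (coord c p)))"
      using has_derivative_chart_transition[OF assms] has_derivative_linear by blast
    then show ?thesis
      using True by (simp add: tangent_vector_def linear_add linear_cmul)
  qed (simp add: tangent_vector_def)
qed

lemma smooth_map_chart_point:
  assumes "smooth_map M A N B u" and "c \<in> charts_at A p" and "d \<in> charts_at B (u p)"
  shows "smooth_on (coord d \<circ> u \<circ> param c) (coord c ` (domain c \<inter> u -` domain d))"
    and "coord c p \<in> coord c ` (domain c \<inter> u -` domain d)"
  using assms by (auto simp: smooth_map_def charts_at_def)

lemma differential_in_chart:
  assumes A: "smooth_atlas M A" and u: "smooth_map M A N B u" and "p \<in> topspace M"
    and c: "c \<in> charts_at A p" and d: "d \<in> charts_at B (u p)" and v: "v \<in> tangent_space A p"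
  shows "differential A B u p v d =
    frechet_derivative (coord d \<circ> u \<circ> param c) (at (coord c p)) (v c)"
proof -
  let ?c = "chart_at A p"
  have c0: "?c \<in> charts_at A p" using A \<open>p \<in> topspace M\<close> by (rule chart_at_in)
  have "(coord d \<circ> u \<circ> param c) differentiable (at (coord c p))"
    using smooth_map_chart_point[OF u c d] by (rule smooth_on_differentiable)
  from frechet_derivative_at[OF has_derivative_chart_change[OF A c0 c this]]
  have "frechet_derivative (coord d \<circ> u \<circ> param ?c) (at (coord ?c p)) (v ?c) =
    frechet_derivative (coord d \<circ> u \<circ> param c) (at (coord c p))
      (frechet_derivative (coord c \<circ> param ?c) (at (coord ?c p)) (v ?c))"
    by metis
  moreover have "frechet_derivative (coord c \<circ> param ?c) (at (coord ?c p)) (v ?c) = v c"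
    using v c0 c by (rule tangent_space_transition)
  ultimately show ?thesis using d by (simp add: differential_def)
qed

lemma real_chart_simps: "charts_at {real_chart} t = {real_chart}" "coord real_chart = id"
  by (auto simp: charts_at_def real_chart_def)

lemma smooth_function_in_chart:
  assumes "smooth_map M A euclideanreal {real_chart} f" and "c \<in> A"
  shows "smooth_on (f \<circ> param c) (chart_image c)"
  using assms by (force simp: smooth_map_def real_chart_def chart_image_def)

lemma dform_in_chart:
  assumes "smooth_atlas M A" and "smooth_map M A euclideanreal {real_chart} f" and "p \<in> topspace M"
    and "c \<in> charts_at A p" and "v \<in> tangent_space A p"
  shows "dform A f p v = frechet_derivative (f \<circ> param c) (at (coord c p)) (v c)"
  using differential_in_chart[OF assms(1-4) _ assms(5), of real_chart]
  by (simp add: dform_def real_chart_simps)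

lemma critical_point_in_chart:
  assumes A: "smooth_atlas M A" and "smooth_map M A euclideanreal {real_chart} f" and "p \<in> topspace M"
    and c: "c \<in> charts_at A p"
  shows "critical_point A f p \<longleftrightarrow> (\<forall>x. frechet_derivative (f \<circ> param c) (at (coord c p)) x = 0)"
proof
  assume "critical_point A f p"
  then show "\<forall>x. frechet_derivative (f \<circ> param c) (at (coord c p)) x = 0"
    using dform_in_chart[OF assms] tangent_vector_in_tangent_space[OF A c] tangent_vector_apply[OF A c]
    unfolding critical_point_def by metis
qed (use dform_in_chart[OF assms] in \<open>auto simp: critical_point_def\<close>)
section \<open>The metric and the gradient in charts\<close>

lemma metric_bilinear_in_chart:
  assumes A: "smooth_atlas M A" and g: "riemannian_metric M A g" and p: "p \<in> topspace M"
    and c: "c \<in> charts_at A p"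
  shows "bilinear (\<lambda>x y. g p (tangent_vector A p c x) (tangent_vector A p c y))" (is "bilinear ?G")
    and "x \<noteq> 0 \<Longrightarrow> g p (tangent_vector A p c x) (tangent_vector A p c x) > 0"
proof -
  note tv = tangent_vector_in_tangent_space[OF A c]
  have sym: "?G x y = ?G y x" for x y
    using g p tv unfolding riemannian_metric_def by blast
  have comb: "?G (a *\<^sub>R x + b *\<^sub>R y) z = a * ?G x z + b * ?G y z" for a b x y z
    using g p tv unfolding riemannian_metric_def tangent_vector_linear[OF A c] by blast
  have "linear (\<lambda>x. ?G x y)" for y
    using comb[of 1 _ 1 _ y] comb[of _ _ 0 0 y] by (intro linearI) auto
  then show "bilinear ?G"
    unfolding bilinear_def using sym by simp
  assume "x \<noteq> 0"
  then have "tangent_vector A p c x \<noteq> (\<lambda>d. 0)"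
    using tangent_vector_apply[OF A c, of x] by metis
  then show "?G x x > 0"
    using g p tv unfolding riemannian_metric_def by blast
qed

text \<open>
  The gradient is a definite description; it denotes because the metric represents \<open>df\<close> by
  a unique tangent vector. The same fact, read in a chart, is the defining property of the gradient.
\<close>
lemma gradient_in_chart:
  assumes A: "smooth_atlas M A" and g: "riemannian_metric M A g"
    and f: "smooth_map M A euclideanreal {real_chart} f" and p: "p \<in> topspace M"
    and c: "c \<in> charts_at A p"
  shows "gradient A g f p \<in> tangent_space A p"
    and "g p (tangent_vector A p c (gradient A g f p c)) (tangent_vector A p c y) =
      frechet_derivative (f \<circ> param c) (at (coord c p)) y"
proof -
  let ?G = "\<lambda>x y. g p (tangent_vector A p c x) (tangent_vector A p c y)"
  let ?l = "frechet_derivative (f \<circ> param c) (at (coord c p))"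
  note G = metric_bilinear_in_chart[OF A g p c]
  note tv = tangent_vector_in_tangent_space[OF A c]
  have df: "dform A f p (tangent_vector A p c y) = ?l y" for y
    using dform_in_chart[OF A f p c tv] tangent_vector_apply[OF A c] by simp
  have "coord c p \<in> chart_image c" using charts_atD[OF c] by (auto simp: chart_image_def)
  then have "linear ?l"
    using smooth_on_has_derivative[OF smooth_function_in_chart[OF f charts_atD(1)[OF c]]]
      has_derivative_linear by blast
  then obtain x where x: "\<And>y. ?G x y = ?l y"
    using riesz_representation_bilinear[OF G] by blast
  have "gradient A g f p = tangent_vector A p c x"
    unfolding gradient_def
  proof (rule the_equality)
    have "g p (tangent_vector A p c x) w = dform A f p w" if "w \<in> tangent_space A p" for w
      using x[of "w c"] df[of "w c"] tangent_vector_coordinate[OF c that] by simp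
    then show "tangent_vector A p c x \<in> tangent_space A p \<and>
      (\<forall>w\<in>tangent_space A p. g p (tangent_vector A p c x) w = dform A f p w)"
      using tv by blast
  next
    fix v assume v: "v \<in> tangent_space A p \<and> (\<forall>w\<in>tangent_space A p. g p v w = dform A f p w)"
    then have v_eq: "tangent_vector A p c (v c) = v"
      using tangent_vector_coordinate[OF c] by blast
    have "?G (v c) y = ?G x y" for y
      using v tv v_eq df x by simp
    moreover have "?G (v c - x) y = ?G (v c) y - ?G x y" for y
      by (rule bilinear_lsub[OF G(1)])
    ultimately have "?G (v c - x) (v c - x) = 0" by simp
    then have "v c - x = 0" using G(2)[of "v c - x"] by linarith
    then show "v = tangent_vector A p c x" using v_eq by simp
  qed
  then show "gradient A g f p \<in> tangent_space A p" and
    "?G (gradient A g f p c) y = ?l y"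
    using tv x tangent_vector_apply[OF A c] by simp_all
qed

section \<open>Minima of a function on the fibres of a map\<close>

text \<open>
  All hypotheses transfer to a closed ball in a chart around \<open>q\<close> whose image under \<open>u\<close> lies in a single
  chart \<open>d\<close> around \<open>u q\<close>; there \<open>coord d\<close> is injective, so the fibres of \<open>u\<close> are level sets of its
  coordinate expression.
\<close>
lemma fibre_minimum_critical:
  fixes M :: "'m topology" and A :: "('m, 'e::{real_inner, heine_borel}) chart set"
    and N :: "'n topology" and B :: "('n, 'f::{real_inner, heine_borel}) chart set"
  assumes A: "smooth_atlas M A" and g: "riemannian_metric M A g"
    and B: "smooth_atlas N B" and u: "smooth_map M A N B u"
    and f: "smooth_map M A euclideanreal {real_chart} f"
    and du: "\<And>p. p \<in> topspace M \<Longrightarrow> differential A B u p (gradient A g f p) = (\<lambda>d. 0)"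
    and q: "q \<in> topspace M" and min: "\<And>p. p \<in> topspace M \<Longrightarrow> u p = u q \<Longrightarrow> f q \<le> f p"
  shows "critical_point A f q"
proof -
  obtain c where c: "c \<in> charts_at A q" using chart_at_in[OF A q] by blast
  have "u q \<in> topspace N" 
    using u q unfolding smooth_map_def continuous_map_def by blast
  then obtain d where d: "d \<in> charts_at B (u q)" using chart_at_in[OF B] by blast
  note cA = charts_atD[OF c] and dB = charts_atD[OF d]
  have ch: "chart_on M c" "chart_on N d"
    using A B cA(1) dB(1) by (auto simp: smooth_atlas_chart)
  define S where "S = coord c ` (domain c \<inter> u -` domain d)"
  have "openin M {x \<in> topspace M. u x \<in> domain d}"
    using u ch(2) by (auto simp: smooth_map_def chart_on_def intro: openin_continuous_map_preimage)
  then have "open (coord c ` (domain c \<inter> {x \<in> topspace M. u x \<in> domain d}))"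
    by (rule open_coord_image[OF ch(1)])
  moreover have "domain c \<inter> {x \<in> topspace M. u x \<in> domain d} = domain c \<inter> u -` domain d"
    using chart_on_domain[OF ch(1)] by auto
  ultimately have "open S" by (simp add: S_def)
  moreover have qS: "coord c q \<in> S" using cA dB by (auto simp: S_def)
  ultimately obtain R where R: "R > 0" "cball (coord c q) R \<subseteq> S"
    using open_contains_cball by blast
  have S_image: "S \<subseteq> chart_image c" by (auto simp: S_def chart_image_def)
  have smooth_u: "smooth_on (coord d \<circ> u \<circ> param c) S"
    using u cA dB by (simp add: smooth_map_def S_def)
  have smooth_f: "smooth_on (f \<circ> param c) S"
    using smooth_function_in_chart[OF f cA(1)] S_image by (rule smooth_on_subset)
  let ?G = "\<lambda>z x y. g (param c z) (tangent_vector A (param c z) c x) (tangent_vector A (param c z) c y)"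
  have smooth_G: "smooth_on (\<lambda>z. ?G z x y) S" for x y
    using g cA S_image unfolding riemannian_metric_def by (blast intro: smooth_on_subset)
  have pt: "param c z \<in> topspace M" "c \<in> charts_at A (param c z)" "d \<in> charts_at B (u (param c z))"
    "coord c (param c z) = z" if "z \<in> cball (coord c q) R" for z
  proof -
    have "z \<in> S" using that R(2) by blast
    then have "param c z \<in> domain c \<inter> u -` domain d"
      unfolding S_def by (rule param_image_subset[OF ch(1)])
    then show "param c z \<in> topspace M" "c \<in> charts_at A (param c z)" "d \<in> charts_at B (u (param c z))"
      using chart_on_domain[OF ch(1)] cA(1) dB(1) by (auto intro: charts_atI)
    show "coord c (param c z) = z" using \<open>z \<in> S\<close> S_image by (intro coord_param) blast
  qed
  have "frechet_derivative (f \<circ> param c) (at (coord c q)) w = 0" for w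
  proof (rule euclidean_fibre_minimum_critical[OF R(1), where h = "coord d \<circ> u \<circ> param c" and \<phi> = "f \<circ> param c"
        and G = ?G and X = "\<lambda>z. gradient A g f (param c z) c"])
    fix y assume y: "y \<in> cball (coord c q) R"
    then have "y \<in> S" using R(2) by blast
    show "(coord d \<circ> u \<circ> param c has_derivative frechet_derivative (coord d \<circ> u \<circ> param c) (at y)) (at y)"
      "(f \<circ> param c has_derivative frechet_derivative (f \<circ> param c) (at y)) (at y)"
      using smooth_u smooth_f \<open>y \<in> S\<close> by (blast intro: smooth_on_has_derivative)+
    show "bilinear (?G y)" "\<And>x. x \<noteq> 0 \<Longrightarrow> ?G y x x > 0"
      by (rule metric_bilinear_in_chart[OF A g pt(1,2)[OF y]], assumption?)+
    show "?G y (gradient A g f (param c y) c) w = frechet_derivative (f \<circ> param c) (at y) w" for w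
      using gradient_in_chart(2)[OF A g f pt(1,2)[OF y]] pt(4)[OF y] by simp
    show "frechet_derivative (coord d \<circ> u \<circ> param c) (at y) (gradient A g f (param c y) c) = 0"
      using differential_in_chart[OF A u pt(1-3)[OF y] gradient_in_chart(1)[OF A g f pt(1,2)[OF y]]]
        du[OF pt(1)[OF y]] pt(4)[OF y] by simp
    assume "(coord d \<circ> u \<circ> param c) y = (coord d \<circ> u \<circ> param c) (coord c q)"
    then have "coord d (u (param c y)) = coord d (u q)"
      using param_coord[OF ch(1) cA(2)] by simp
    then have "u (param c y) = u q"
      using chart_on_inj[OF ch(2)] charts_atD(2)[OF pt(3)[OF y]] dB(2) by (meson inj_onD)
    then show "(f \<circ> param c) (coord c q) \<le> (f \<circ> param c) y"
      using min[OF pt(1)[OF y]] param_coord[OF ch(1) cA(2)] by simp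
  next
    show "continuous_on (cball (coord c q) R) (\<lambda>y. frechet_derivative (f \<circ> param c) (at y) w)" for w
      using smooth_on_continuous[OF smooth_on_derivative[OF smooth_f]] R(2) by (rule continuous_on_subset)
    show "continuous_on (cball (coord c q) R) (\<lambda>z. ?G z a b)" for a b
      using smooth_on_continuous[OF smooth_G] R(2) by (rule continuous_on_subset)
  qed
  then show ?thesis using critical_point_in_chart[OF A f q c] by blast
qed

section \<open>Critical points of Morse functions\<close>

text \<open>
  If common zeros \<open>x\<^sub>n \<noteq> x0\<close> converged to \<open>x0\<close>, then a limit \<open>a\<close> of the unit vectors pointing from \<open>x0\<close>
  to \<open>x\<^sub>n\<close> would be annihilated by every derivative \<open>D w\<close>. Applied to the first derivatives of a
  function, whose derivatives make up the Hessian, it shows that nondegenerate critical points are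
  isolated.
\<close>
lemma isolated_common_zero:
  fixes \<psi> :: "'w \<Rightarrow> 'a::{real_inner, heine_borel} \<Rightarrow> real"
  assumes der: "\<And>w. (\<psi> w has_derivative D w) (at x0)" and "\<And>w. \<psi> w x0 = 0"
    and inj: "\<And>v. \<forall>w. D w v = 0 \<Longrightarrow> v = 0"
  shows "\<exists>e>0. \<forall>x\<in>ball x0 e. (\<forall>w. \<psi> w x = 0) \<longrightarrow> x = x0"
proof (rule ccontr)
  assume no_ball: "\<not> ?thesis"
  then have "\<exists>x. x \<in> ball x0 (inverse (real (Suc n))) \<and> (\<forall>w. \<psi> w x = 0) \<and> x \<noteq> x0" for n
    using no_ball by (metis inverse_positive_iff_positive of_nat_0_less_iff zero_less_Suc)
  then obtain x where x: "\<And>n. dist x0 (x n) < inverse (real (Suc n))"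
    and zero: "\<And>n w. \<psi> w (x n) = 0" and ne: "\<And>n. x n \<noteq> x0"
    by (auto simp: mem_ball) metis
  have "(\<lambda>n. dist (x n) x0) \<longlonglongrightarrow> 0"
    by (rule tendsto_sandwich[OF _ _ tendsto_const LIMSEQ_inverse_real_of_nat])
       (use x in \<open>auto simp: dist_commute less_imp_le\<close>)
  then have "x \<longlonglongrightarrow> x0" by (rule tendsto_dist_iff[THEN iffD2])
  \<comment> \<open>The directions of approach lie on the compact unit sphere.\<close>
  define v where "v n = sgn (x n - x0)" for n
  have "v n \<in> sphere 0 1" for n using ne by (simp add: v_def norm_sgn)
  then obtain s a where a: "a \<in> sphere (0::'a) 1" "strict_mono (s :: nat \<Rightarrow> nat)"
    and lim: "(v \<circ> s) \<longlonglongrightarrow> a"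
    using compact_unit_sphere[where 'a = 'a, unfolded compact_def] by metis
  have "D w a = 0" for w
  proof -
    have bl: "bounded_linear (D w)" using der has_derivative_bounded_linear by blast
    have "filterlim x (at x0) sequentially"
      using \<open>x \<longlonglongrightarrow> x0\<close> ne by (simp add: filterlim_at)
    then have "(\<lambda>n. norm ((\<psi> w (x n) - \<psi> w x0) - D w (x n - x0)) / norm (x n - x0)) \<longlonglongrightarrow> 0"
      using der[of w, unfolded has_derivative_iff_norm] filterlim_compose by blast
    moreover have "norm ((\<psi> w (x n) - \<psi> w x0) - D w (x n - x0)) / norm (x n - x0) = \<bar>D w (v n)\<bar>" for n
      using zero assms(2) linear_cmul[OF bounded_linear.linear[OF bl]]
      by (simp add: v_def sgn_div_norm divide_inverse abs_mult)
    ultimately have "(\<lambda>n. \<bar>D w (v n)\<bar>) \<longlonglongrightarrow> 0" by simp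
    then have "(\<lambda>n. D w (v n)) \<longlonglongrightarrow> 0" by (rule tendsto_rabs_zero_cancel)
    then have "(\<lambda>n. D w (v (s n))) \<longlonglongrightarrow> 0"
      using LIMSEQ_subseq_LIMSEQ[OF _ a(2)] by (fastforce simp: o_def)
    moreover have "(\<lambda>n. D w (v (s n))) \<longlonglongrightarrow> D w a"
      using bounded_linear.tendsto[OF bl lim] by (simp add: o_def)
    ultimately show ?thesis using LIMSEQ_unique by blast
  qed
  then have "a = 0" by (intro inj allI)
  then show False using a(1) by simp
qed

text \<open>
  Around a point that is not critical, a partial derivative stays nonzero by continuity; around a
  critical point the nondegenerate Hessian excludes further critical points.
\<close>
lemma morse_critical_points_isolated:
  assumes A: "smooth_atlas M A" and f: "morse_function M A f" and p: "p \<in> topspace M"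
  obtains U where "openin M U" "p \<in> U" "\<And>x. x \<in> U \<Longrightarrow> critical_point A f x \<Longrightarrow> x = p"
proof -
  have sf: "smooth_map M A euclideanreal {real_chart} f"
    using f by (simp add: morse_function_def)
  \<comment> \<open>The Hessian at \<open>p\<close> is defined through this particular chart.\<close>
  define c where "c = chart_at A p"
  have c: "c \<in> charts_at A p" unfolding c_def by (rule chart_at_in[OF A p])
  note cA = charts_atD[OF c]
  have ch: "chart_on M c" using A cA(1) by (rule smooth_atlas_chart)
  have x0: "coord c p \<in> chart_image c" using cA(2) by (simp add: chart_image_def)
  define \<psi> where "\<psi> w z = frechet_derivative (f \<circ> param c) (at z) w" for w z
  have smooth_\<psi>: "smooth_on (\<psi> w) (chart_image c)" for w
    unfolding \<psi>_def by (rule smooth_on_derivative[OF smooth_function_in_chart[OF sf cA(1)]])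
  have crit: "critical_point A f x \<longleftrightarrow> (\<forall>w. \<psi> w (coord c x) = 0)" if "x \<in> domain c" for x
    unfolding \<psi>_def
    using critical_point_in_chart[OF A sf _ charts_atI[OF cA(1) that]] chart_on_domain[OF ch] that by blast
  obtain V where V: "open V" "coord c p \<in> V" "\<And>z. z \<in> V \<Longrightarrow> (\<And>w. \<psi> w z = 0) \<Longrightarrow> z = coord c p"
  proof (cases "critical_point A f p")
    case True
    have "v = 0" if v: "\<forall>w. frechet_derivative (\<psi> w) (at (coord c p)) v = 0" for v
    proof -
      have "hessian A f p (tangent_vector A p c v) w = 0" for w
        using v[rule_format, of "w c"] tangent_vector_apply[OF A c]
        by (simp add: hessian_def Let_def c_def[symmetric] \<psi>_def[abs_def])
      then have "tangent_vector A p c v = (\<lambda>d. 0)"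
        using f p True tangent_vector_in_tangent_space[OF A c] unfolding morse_function_def by blast
      then show ?thesis using tangent_vector_apply[OF A c] by metis
    qed
    note nondegenerate = this
    have zero: "\<psi> w (coord c p) = 0" for w
      using True crit[OF cA(2)] by blast
    obtain e where "e > 0"
      "\<forall>x\<in>ball (coord c p) e. (\<forall>w. \<psi> w x = 0) \<longrightarrow> x = coord c p"
      using isolated_common_zero[of \<psi>, OF smooth_on_has_derivative[OF smooth_\<psi> x0] zero nondegenerate]
      by blast
    then show ?thesis using that[of "ball (coord c p) e"] by auto
  next
    case False
    then obtain w where w: "\<psi> w (coord c p) \<noteq> 0" using crit[OF cA(2)] by blast
    have "open (chart_image c \<inter> \<psi> w -` (- {0}))"
      using smooth_on_continuous[OF smooth_\<psi>] ch
      by (intro continuous_open_preimage) (auto simp: chart_on_def)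
    then show ?thesis using that w x0 by blast
  qed
  show thesis
  proof (rule that)
    show "openin M {x \<in> domain c. coord c x \<in> V}" by (rule openin_coord_preimage[OF ch V(1)])
    show "p \<in> {x \<in> domain c. coord c x \<in> V}" using cA(2) V(2) by simp
    fix x assume x: "x \<in> {x \<in> domain c. coord c x \<in> V}" "critical_point A f x"
    then have "coord c x = coord c p" using V(3) crit by blast
    with chart_on_inj[OF ch] show "x = p"
      by (rule inj_onD) (use x(1) cA(2) in auto)
  qed
qed

text \<open>
  An infinite set of critical points would accumulate at some point of the compact manifold.
\<close>
lemma morse_finite_critical_points:
  assumes A: "smooth_atlas M A" and f: "morse_function M A f" and "compact_space M"
  shows "finite {p \<in> topspace M. critical_point A f p}" (is "finite ?C")
proof (rule ccontr)
  assume "infinite ?C"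
  then obtain p where p: "p \<in> M derived_set_of ?C"
    using compact_space_imp_Bolzano_Weierstrass[OF assms(3)] by blast
  then have "p \<in> topspace M" using in_derived_set_of by metis
  then obtain U where "openin M U" "p \<in> U" "\<And>x. x \<in> U \<Longrightarrow> critical_point A f x \<Longrightarrow> x = p"
    using morse_critical_points_isolated[OF A f] by metis
  then show False using p unfolding in_derived_set_of by blast
qed

section \<open>Maps annihilating the gradient of a Morse function\<close>

text \<open>
  A fibre is closed, and so is its complement as the preimage of a finite set.
\<close>
lemma finite_image_connected_imp_constant:
  assumes "connected_space M" and "continuous_map M N u" and "t1_space N"
    and "finite (u ` topspace M)"
  shows "u constant_on topspace M"
proof (cases "topspace M = {}")
  case True
  then show ?thesis by (simp add: constant_on_def)
next
  case False
  then obtain p where p: "p \<in> topspace M" by blast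
  let ?T = "{x \<in> topspace M. u x \<in> {u p}}"
  let ?T' = "{x \<in> topspace M. u x \<in> u ` topspace M - {u p}}"
  have "u ` topspace M \<subseteq> topspace N"
    using assms(2) by (simp add: continuous_map_image_subset_topspace)
  then have "closedin N {u p}" "closedin N (u ` topspace M - {u p})"
    using assms(3,4) p unfolding t1_space_closedin_finite by blast+
  then have "closedin M ?T" "closedin M ?T'"
    using assms(2) closedin_continuous_map_preimage by blast+
  moreover have "?T' = topspace M - ?T" by auto
  moreover have "?T \<subseteq> topspace M" by auto
  ultimately have "openin M ?T" "closedin M ?T"
    by (simp_all only: openin_closedin_eq simp_thms)
  then have "?T = {} \<or> ?T = topspace M"
    using assms(1) unfolding connected_space_clopen_in by blast
  then show ?thesis using p unfolding constant_on_def by blast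
qed

lemma continuous_map_fibre_attains_minimum:
  assumes "compact_space M" and "continuous_map M N u" and "t1_space N"
    and f: "continuous_map M euclideanreal f" and p: "p \<in> topspace M"
  obtains q where "q \<in> topspace M" "u q = u p" "\<And>x. x \<in> topspace M \<Longrightarrow> u x = u q \<Longrightarrow> f q \<le> f x"
proof -
  let ?K = "{x \<in> topspace M. u x \<in> {u p}}"
  have "u p \<in> topspace N" using assms(2) p by (auto simp: continuous_map_def)
  then have "closedin M ?K"
    using assms(2,3) by (intro closedin_continuous_map_preimage) (auto simp: t1_space_closedin_singleton)
  then have "compactin euclideanreal (f ` ?K)"
    using assms(1) closedin_compact_space image_compactin[OF _ f] by blast
  moreover have "f ` ?K \<noteq> {}" using p by blast
  ultimately obtain q where "q \<in> ?K" "\<And>x. x \<in> ?K \<Longrightarrow> f q \<le> f x"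
    using compact_attains_inf[of "f ` ?K"] by auto
  then show thesis by (intro that[of q]) auto
qed

theorem proposition3p1:
  fixes M :: "'m topology" and A :: "('m, 'e::{real_inner, heine_borel}) chart set"
    and g :: "'m \<Rightarrow> (('m, 'e) chart \<Rightarrow> 'e) \<Rightarrow> (('m, 'e) chart \<Rightarrow> 'e) \<Rightarrow> real"
    and N :: "'n topology" and B :: "('n, 'f::{real_inner, heine_borel}) chart set"
    and u :: "'m \<Rightarrow> 'n"
  assumes "smooth_manifold M A" and "connected_space M" and "compact_space M"
    and "riemannian_metric M A g"
    and "smooth_manifold N B"
    and "smooth_map M A N B u"
    and "\<exists>f. morse_function M A f \<and>
           (\<forall>p\<in>topspace M. differential A B u p (gradient A g f p) = (\<lambda>d. 0))"
  shows "u constant_on topspace M"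
proof -
  obtain f where f: "morse_function M A f"
    and du: "\<And>p. p \<in> topspace M \<Longrightarrow> differential A B u p (gradient A g f p) = (\<lambda>d. 0)"
    using assms(7) by blast
  have A: "smooth_atlas M A" and B: "smooth_atlas N B" and N: "t1_space N"
    using assms(1,5) Hausdorff_imp_t1_space by (auto simp: smooth_manifold_def)
  have sf: "smooth_map M A euclideanreal {real_chart} f"
    using f by (simp add: morse_function_def)
  have cont: "continuous_map M N u" "continuous_map M euclideanreal f"
    using assms(6) sf by (simp_all add: smooth_map_def)
  have "u p \<in> u ` {q \<in> topspace M. critical_point A f q}" if p: "p \<in> topspace M" for p
  proof -
    obtain q where q: "q \<in> topspace M" "u q = u p" "\<And>x. x \<in> topspace M \<Longrightarrow> u x = u q \<Longrightarrow> f q \<le> f x"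
      using continuous_map_fibre_attains_minimum[OF assms(3) cont(1) N cont(2) p] by blast
    have "critical_point A f q"
      by (rule fibre_minimum_critical[OF A assms(4) B assms(6) sf du q(1,3)])
    then show ?thesis using q(1,2) by (metis (mono_tags, lifting) imageI mem_Collect_eq)
  qed
  then have "u ` topspace M \<subseteq> u ` {q \<in> topspace M. critical_point A f q}" by blast
  then have "finite (u ` topspace M)"
    using morse_finite_critical_points[OF A f assms(3)] finite_surj by blast
  then show ?thesis
    by (rule finite_image_connected_imp_constant[OF assms(2) cont(1) N])
qed

end
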